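(* Let $D=\prod_{i=1}^d D_i$ with $D_i\subset\mathbb{R}$ nonempty, and let $Z=(Z_{\mathbf{x}})_{\mathbf{x}\in D}$ be a real-valued centred random field possessing a covariance kernel $k$. Then $Z$ has additive paths (up to a modification) if and only if $k$ is a positive definite kernel of the form $$k(\mathbf{x},\mathbf{x}')=\sum_{i=1}^d\sum_{j=1}^d k_{ij}(x_i,x_j')\qquad(\mathbf{x},\mathbf{x}'\in D)$$ for some functions $k_{ij}:D_i\times D_j\to\mathbb{R}$ ($1\le i,j\le d$).
   Context: A function $f\in\mathbb{R}^D$ is additive if there exist $f_i\in\mathbb{R}^{D_i}$ ($1\le i\le d$) such that $f(\mathbf{x})=\sum_{i=1}^d f_i(x_i)$ for all $\mathbf{x}=(x_1,\dots,x_d)\in D$. $Z$ has additive paths up to a modification if there exists a random field $A=(A_{\mathbf{x}})_{\mathbf{x}\in D}$ (on the same probability space) whose paths are additive functions and such that $\mathbb{P}(Z_{\mathbf{x}}=A_{\mathbf{x}})=1$ for all $\mathbf{x}\in D$. "Possessing a covariance kernel $k$" means $\mathbb{E}[Z_{\mathbf{x}}^2]<\infty$ for all $\mathbf{x}\in D$ and $k(\mathbf{x},\mathbf{x}')=\operatorname{cov}(Z_{\mathbf{x}},Z_{\mathbf{x}'})$; "centred" means $\mathbb{E}[Z_{\mathbf{x}}]=0$ for all $\mathbf{x}$. "Positive definite" is meant in the loose sense: $k$ is symmetric and $\sum_{a,b}c_ac_bk(\mathbf{x}_a,\mathbf{x}_b)\ge0$ for all finite families of points $\mathbf{x}_a \in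 D$ and reals $c_a$. *)

theory Defs
  imports "HOL-Probability.Probability"
begin

text \<open>
  A function on a subset \<open>D\<close> of \<open>\<real>\<^sup>d\<close> is represented by a total function, of which only the
  values on \<open>D\<close> are ever used; likewise for functions on the factors of \<open>D\<close> and for random fields
  indexed by \<open>D\<close>. The dimension is the cardinality of the index type \<open>'d\<close>.
\<close>

definition product_domain :: "('d::finite \<Rightarrow> real set) \<Rightarrow> (real ^ 'd) set" where
  "product_domain E = {x. \<forall>i. x $ i \<in> E i}"

definition additive_function :: "('d::finite \<Rightarrow> real set) \<Rightarrow> (real ^ 'd \<Rightarrow> real) \<Rightarrow> bool" where
  "additive_function E f \<longleftrightarrow>
     (\<exists>g :: 'd \<Rightarrow> real \<Rightarrow> real. \<forall>x\<in>product_domain E. f x = (\<Sum>i\<in>UNIV. g i (x $ i)))"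

definition random_field :: "'w measure \<Rightarrow> 'x set \<Rightarrow> ('x \<Rightarrow> 'w \<Rightarrow> real) \<Rightarrow> bool" where
  "random_field M D Z \<longleftrightarrow> (\<forall>x\<in>D. Z x \<in> borel_measurable M)"

text \<open>
  Every path of \<open>A\<close> is additive, but its summands may depend on the outcome in an arbitrary
  (possibly non-measurable) way.
\<close>

definition additive_paths_up_to_modification ::
  "'w measure \<Rightarrow> ('d::finite \<Rightarrow> real set) \<Rightarrow> (real ^ 'd \<Rightarrow> 'w \<Rightarrow> real) \<Rightarrow> bool" where
  "additive_paths_up_to_modification M E Z \<longleftrightarrow>
     (\<exists>A. random_field M (product_domain E) A \<and>
          (\<forall>\<omega>\<in>space M. additive_function E (\<lambda>x. A x \<omega>)) \<and>
          (\<forall>x\<in>product_domain E. \<P>(\<omega> in M. Z x \<omega> = A x \<omega>) = 1))"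

definition centred :: "'w measure \<Rightarrow> 'x set \<Rightarrow> ('x \<Rightarrow> 'w \<Rightarrow> real) \<Rightarrow> bool" where
  "centred M D Z \<longleftrightarrow> (\<forall>x\<in>D. integral\<^sup>L M (Z x) = 0)"

definition covariance :: "'w measure \<Rightarrow> ('w \<Rightarrow> real) \<Rightarrow> ('w \<Rightarrow> real) \<Rightarrow> real" where
  "covariance M X Y =
     integral\<^sup>L M (\<lambda>\<omega>. (X \<omega> - integral\<^sup>L M X) * (Y \<omega> - integral\<^sup>L M Y))"

text \<open>
  On a probability space, square integrability of a random field makes all integrals in its means
  and covariances exist, so the convention that the integral of a non-integrable function is 0
  plays no role.
\<close>

definition has_covariance_kernel ::
  "'w measure \<Rightarrow> 'x set \<Rightarrow> ('x \<Rightarrow> 'w \<Rightarrow> real) \<Rightarrow> ('x \<Rightarrow> 'x \<Rightarrow> real) \<Rightarrow> bool" where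
  "has_covariance_kernel M D Z k \<longleftrightarrow>
     (\<forall>x\<in>D. integrable M (\<lambda>\<omega>. (Z x \<omega>)\<^sup>2)) \<and>
     (\<forall>x\<in>D. \<forall>x'\<in>D. k x x' = covariance M (Z x) (Z x'))"

text \<open>
  Positive definiteness in the loose sense: the quadratic forms are only required to be nonnegative.
  Points of a finite family may be repeated.
\<close>

definition positive_definite_kernel :: "'x set \<Rightarrow> ('x \<Rightarrow> 'x \<Rightarrow> real) \<Rightarrow> bool" where
  "positive_definite_kernel D k \<longleftrightarrow>
     (\<forall>x\<in>D. \<forall>x'\<in>D. k x x' = k x' x) \<and>
     (\<forall>(n::nat) (p :: nat \<Rightarrow> 'x) (c :: nat \<Rightarrow> real). (\<forall>a<n. p a \<in> D) \<longrightarrow>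
        0 \<le> (\<Sum>a<n. \<Sum>b<n. c a * c b * k (p a) (p b)))"

end

theory Submission
  imports Defs
begin

text \<open>
  Fix an anchor \<open>a\<close> in the domain. An additive function \<open>f\<close> is determined by its values at the
  points that differ from \<open>a\<close> in at most one coordinate: with \<open>d\<close> coordinates, \<open>f x\<close> is the sum
  over \<open>i\<close> of the values of \<open>f\<close> at \<open>a\<close> with \<open>i\<close>-th coordinate replaced by that of \<open>x\<close>, minus
  \<open>(d - 1) f a\<close>. Spreading the correction evenly over the coordinates gives canonical summands, and
  \<open>f\<close> is additive exactly when it is the sum of its canonical summands
  (\<open>additive_function_iff_anchored\<close>). Each canonical summand is a linear combination of two values
  of \<open>f\<close>. For a square-integrable random field the canonical summands are therefore square-integrable
  random variables, whereas the given summands of an additive path may be non-measurable in the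
  outcome.

  If \<open>Z\<close> has an additive modification, then at each point \<open>Z\<close> almost surely equals the sum of its
  canonical summands, because only finitely many points are involved
  (\<open>additive_paths_up_to_modification_iff_anchored\<close>). Expanding the expectation of a
  product bilinearly splits the kernel into covariances of summands. Positive definiteness holds for
  every covariance kernel, by the same expansion applied to the square of a linear combination.

  Conversely, if the kernel splits, then \<open>k (\<cdot>, y)\<close> is additive for every \<open>y\<close>. Hence the difference
  \<open>R\<close> between \<open>Z x\<close> and the sum of the canonical summands of \<open>Z\<close> at \<open>x\<close> is orthogonal in \<open>L\<^sup>2\<close> to
  every \<open>Z y\<close>. As \<open>R\<close> is itself a linear combination of such variables, \<open>R\<close> is orthogonal to itself
  and vanishes almost surely, so the sum of the canonical summands is an additive modification.
\<close>

section \<open>Canonical summands of an additive function\<close>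

definition replace_coord :: "real ^ 'd::finite \<Rightarrow> 'd \<Rightarrow> real \<Rightarrow> real ^ 'd" where
  "replace_coord a i t = (\<chi> j. if j = i then t else a $ j)"

definition anchored_summand ::
  "real ^ 'd::finite \<Rightarrow> (real ^ 'd \<Rightarrow> real) \<Rightarrow> 'd \<Rightarrow> real \<Rightarrow> real" where
  "anchored_summand a f i t =
     f (replace_coord a i t) - (real CARD('d) - 1) / real CARD('d) * f a"

lemma replace_coord_in_product_domain:
  assumes "a \<in> product_domain E" "t \<in> E i"
  shows "replace_coord a i t \<in> product_domain E"
  using assms by (auto simp: product_domain_def replace_coord_def)

lemma product_domain_coord:
  assumes "x \<in> product_domain E"
  shows "x $ i \<in> E i"
  using assms by (auto simp: product_domain_def)

lemma anchored_summand_cong: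
  assumes "\<And>x. x \<in> product_domain E \<Longrightarrow> f x = g x"
    and "a \<in> product_domain E" "t \<in> E i"
  shows "anchored_summand a f i t = anchored_summand a g i t"
  using assms by (simp add: anchored_summand_def replace_coord_in_product_domain)

text \<open>
  Moving the anchor to \<open>x\<close> in the \<open>i\<close>-th coordinate only changes \<open>f\<close> by the increment of its
  \<open>i\<close>-th summand, and these increments add up to \<open>f x - f a\<close>. The \<open>d\<close> partly moved points
  therefore give \<open>d\<close> copies of \<open>f a\<close> plus \<open>f x - f a\<close>, and the correction term removes the
  \<open>d - 1\<close> copies in excess.
\<close>

lemma additive_function_iff_anchored:
  fixes E :: "'d::finite \<Rightarrow> real set"
  assumes a: "a \<in> product_domain E"
  shows "additive_function E f \<longleftrightarrow>
    (\<forall>x\<in>product_domain E. f x = (\<Sum>i\<in>UNIV. anchored_summand a f i (x $ i)))"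
proof
  assume "additive_function E f"
  then obtain g where g: "\<And>x. x \<in> product_domain E \<Longrightarrow> f x = (\<Sum>i\<in>UNIV. g i (x $ i))"
    unfolding additive_function_def by blast
  show "\<forall>x\<in>product_domain E. f x = (\<Sum>i\<in>UNIV. anchored_summand a f i (x $ i))"
  proof
    fix x assume x: "x \<in> product_domain E"
    have replaced: "f (replace_coord a i (x $ i)) = f a + (g i (x $ i) - g i (a $ i))" for i
    proof -
      have "f (replace_coord a i (x $ i)) - f a =
          (\<Sum>j\<in>UNIV. g j (replace_coord a i (x $ i) $ j) - g j (a $ j))"
        using a x by (simp add: g replace_coord_in_product_domain product_domain_coord sum_subtractf)
      also have "\<dots> = (\<Sum>j\<in>UNIV. if j = i then g i (x $ i) - g i (a $ i) else 0)"
        by (intro sum.cong) (auto simp: replace_coord_def)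
      finally show ?thesis by simp
    qed
    have "(\<Sum>i\<in>UNIV. anchored_summand a f i (x $ i)) =
        (\<Sum>i\<in>(UNIV :: 'd set). f a / real CARD('d) + (g i (x $ i) - g i (a $ i)))"
      by (intro sum.cong) (auto simp: anchored_summand_def replaced field_simps)
    also have "\<dots> = f a + (f x - f a)"
      using a x by (simp add: g sum.distrib sum_subtractf)
    finally show "f x = (\<Sum>i\<in>UNIV. anchored_summand a f i (x $ i))" by simp
  qed
next
  assume "\<forall>x\<in>product_domain E. f x = (\<Sum>i\<in>UNIV. anchored_summand a f i (x $ i))"
  then show "additive_function E f"
    unfolding additive_function_def by blast
qed

section \<open>Products of square-integrable random variables\<close>

definition square_integrable :: "'w measure \<Rightarrow> ('w \<Rightarrow> real) \<Rightarrow> bool" where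
  "square_integrable M X \<longleftrightarrow> X \<in> borel_measurable M \<and> integrable M (\<lambda>\<omega>. (X \<omega>)\<^sup>2)"

lemma square_integrable_measurable [measurable_dest]:
  "square_integrable M X \<Longrightarrow> X \<in> borel_measurable M"
  by (simp add: square_integrable_def)

lemma integrable_mult_square_integrable:
  assumes "square_integrable M X" "square_integrable M Y"
  shows "integrable M (\<lambda>\<omega>. X \<omega> * Y \<omega>)"
proof (rule Bochner_Integration.integrable_bound)
  show "integrable M (\<lambda>\<omega>. (X \<omega>)\<^sup>2 + (Y \<omega>)\<^sup>2)"
    using assms by (simp add: square_integrable_def)
  show "(\<lambda>\<omega>. X \<omega> * Y \<omega>) \<in> borel_measurable M"
    using assms by (simp add: square_integrable_def borel_measurable_times)
  show "AE \<omega> in M. norm (X \<omega> * Y \<omega>) \<le> norm ((X \<omega>)\<^sup>2 + (Y \<omega>)\<^sup>2)"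
  proof (rule AE_I2)
    fix \<omega>
    have "0 \<le> (\<bar>X \<omega>\<bar> - \<bar>Y \<omega>\<bar>)\<^sup>2" "0 \<le> \<bar>X \<omega>\<bar> * \<bar>Y \<omega>\<bar>" by simp_all
    then have "\<bar>X \<omega>\<bar> * \<bar>Y \<omega>\<bar> \<le> (X \<omega>)\<^sup>2 + (Y \<omega>)\<^sup>2"
      unfolding power2_diff power2_abs by linarith
    then show "norm (X \<omega> * Y \<omega>) \<le> norm ((X \<omega>)\<^sup>2 + (Y \<omega>)\<^sup>2)"
      by (simp add: abs_mult)
  qed
qed

lemma square_integrable_cmult:
  "square_integrable M X \<Longrightarrow> square_integrable M (\<lambda>\<omega>. c * X \<omega>)"
  by (simp add: square_integrable_def power_mult_distrib borel_measurable_times)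

lemma square_integrable_diff:
  assumes "square_integrable M X" "square_integrable M Y"
  shows "square_integrable M (\<lambda>\<omega>. X \<omega> - Y \<omega>)"
  using assms integrable_mult_square_integrable[OF assms]
  by (simp add: square_integrable_def power2_diff mult.assoc borel_measurable_diff)

lemma square_integrable_add:
  assumes "square_integrable M X" "square_integrable M Y"
  shows "square_integrable M (\<lambda>\<omega>. X \<omega> + Y \<omega>)"
  using assms integrable_mult_square_integrable[OF assms]
  by (simp add: square_integrable_def power2_sum mult.assoc borel_measurable_add)

lemma square_integrable_sum:
  assumes "\<And>i. i \<in> I \<Longrightarrow> square_integrable M (X i)"
  shows "square_integrable M (\<lambda>\<omega>. \<Sum>i\<in>I. X i \<omega>)"
  using assms
proof (induction I rule: infinite_finite_induct)
  case (insert i I)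
  then show ?case by (simp add: square_integrable_add)
qed (simp_all add: square_integrable_def)

lemma integral_sum_mult_sum:
  assumes X: "\<And>i. i \<in> I \<Longrightarrow> square_integrable M (X i)"
    and Y: "\<And>j. j \<in> J \<Longrightarrow> square_integrable M (Y j)"
  shows "(\<integral>\<omega>. (\<Sum>i\<in>I. X i \<omega>) * (\<Sum>j\<in>J. Y j \<omega>) \<partial>M) =
    (\<Sum>i\<in>I. \<Sum>j\<in>J. \<integral>\<omega>. X i \<omega> * Y j \<omega> \<partial>M)"
  using X Y
  by (simp add: sum_product integrable_mult_square_integrable Bochner_Integration.integral_sum)

lemma square_integrable_anchored_summand:
  assumes "square_integrable M (Z (replace_coord a i t))" "square_integrable M (Z a)"
  shows "square_integrable M (\<lambda>\<omega>. anchored_summand a (\<lambda>x. Z x \<omega>) i t)"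
  unfolding anchored_summand_def
  by (intro square_integrable_diff square_integrable_cmult assms)

text \<open>
  Canonical summands are linear in the field, so an \<open>L\<^sup>2\<close> inner product passes inside them. For
  \<open>Y = Z y\<close> with \<open>Z\<close> centred, this turns the summands of \<open>Z\<close> into those of the section \<open>k (\<cdot>, y)\<close>
  of its covariance kernel.
\<close>

lemma integral_anchored_summand_mult:
  assumes "square_integrable M (Z (replace_coord a i t))" "square_integrable M (Z a)"
    and "square_integrable M Y"
  shows "(\<integral>\<omega>. anchored_summand a (\<lambda>x. Z x \<omega>) i t * Y \<omega> \<partial>M) =
    anchored_summand a (\<lambda>x. \<integral>\<omega>. Z x \<omega> * Y \<omega> \<partial>M) i t"
  using assms
  by (simp add: anchored_summand_def left_diff_distrib mult.assoc
      integrable_mult_square_integrable Bochner_Integration.integral_diff)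

section \<open>Additive modifications and split kernels\<close>

text \<open>
  The quadratic form is the second moment of the linear combination of the \<open>Z (p b)\<close> with
  coefficients \<open>c b\<close>.
\<close>

lemma positive_definite_kernel_second_moments:
  assumes sq: "\<And>x. x \<in> D \<Longrightarrow> square_integrable M (Z x)"
    and k: "\<And>x y. x \<in> D \<Longrightarrow> y \<in> D \<Longrightarrow> k x y = (\<integral>\<omega>. Z x \<omega> * Z y \<omega> \<partial>M)"
  shows "positive_definite_kernel D k"
  unfolding positive_definite_kernel_def
proof (intro conjI ballI allI impI)
  fix x y assume "x \<in> D" "y \<in> D"
  then show "k x y = k y x" by (simp add: k mult.commute)
next
  fix n :: nat and p :: "nat \<Rightarrow> 'a" and c :: "nat \<Rightarrow> real"
  assume p: "\<forall>a<n. p a \<in> D"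
  have "0 \<le> (\<integral>\<omega>. (\<Sum>a<n. c a * Z (p a) \<omega>) * (\<Sum>b<n. c b * Z (p b) \<omega>) \<partial>M)"
    by (intro Bochner_Integration.integral_nonneg) simp
  also have "\<dots> = (\<Sum>a<n. \<Sum>b<n. \<integral>\<omega>. (c a * Z (p a) \<omega>) * (c b * Z (p b) \<omega>) \<partial>M)"
    using p by (intro integral_sum_mult_sum square_integrable_cmult sq) auto
  also have "\<dots> = (\<Sum>a<n. \<Sum>b<n. c a * c b * k (p a) (p b))"
  proof (intro sum.cong refl)
    fix a b assume "a \<in> {..<n}" "b \<in> {..<n}"
    then have "k (p a) (p b) = (\<integral>\<omega>. Z (p a) \<omega> * Z (p b) \<omega> \<partial>M)"
      using p by (simp add: k)
    moreover have "(\<lambda>\<omega>. (c a * Z (p a) \<omega>) * (c b * Z (p b) \<omega>)) =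
        (\<lambda>\<omega>. (c a * c b) * (Z (p a) \<omega> * Z (p b) \<omega>))"
      by (simp add: mult_ac)
    ultimately show "(\<integral>\<omega>. (c a * Z (p a) \<omega>) * (c b * Z (p b) \<omega>) \<partial>M) = c a * c b * k (p a) (p b)"
      by simp
  qed
  finally show "0 \<le> (\<Sum>a<n. \<Sum>b<n. c a * c b * k (p a) (p b))" .
qed

text \<open>
  The canonical summands turn the existence of an additive modification into a condition on \<open>Z\<close>
  alone: the identity characterising additivity must hold almost surely at each single point.
\<close>

lemma additive_paths_up_to_modification_iff_anchored:
  fixes E :: "'d::finite \<Rightarrow> real set"
  assumes "prob_space M" and a: "a \<in> product_domain E"
    and Z: "random_field M (product_domain E) Z"
  shows "additive_paths_up_to_modification M E Z \<longleftrightarrow>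
    (\<forall>x\<in>product_domain E. AE \<omega> in M.
       Z x \<omega> = (\<Sum>i\<in>UNIV. anchored_summand a (\<lambda>y. Z y \<omega>) i (x $ i)))"
proof -
  interpret prob_space M by fact
  have meas_Z: "Z x \<in> borel_measurable M" if "x \<in> product_domain E" for x
    using Z that by (simp add: random_field_def)
  have replaced: "replace_coord a i (x $ i) \<in> product_domain E" if "x \<in> product_domain E" for x i
    using a that by (simp add: replace_coord_in_product_domain product_domain_coord)
  have prob_eq_iff: "\<P>(\<omega> in M. Z x \<omega> = Y \<omega>) = 1 \<longleftrightarrow> (AE \<omega> in M. Z x \<omega> = Y \<omega>)"
    if x: "x \<in> product_domain E" and Y: "Y \<in> borel_measurable M" for x and Y :: "_ \<Rightarrow> real"
  proof (rule prob_Collect_eq_1)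
    note [measurable] = meas_Z[OF x] Y
    show "{\<omega> \<in> space M. Z x \<omega> = Y \<omega>} \<in> events" by measurable
  qed
  show ?thesis
  proof
    assume "additive_paths_up_to_modification M E Z"
    then obtain A where A: "random_field M (product_domain E) A"
      and add: "\<And>\<omega>. \<omega> \<in> space M \<Longrightarrow> additive_function E (\<lambda>x. A x \<omega>)"
      and mod: "\<And>x. x \<in> product_domain E \<Longrightarrow> \<P>(\<omega> in M. Z x \<omega> = A x \<omega>) = 1"
      unfolding additive_paths_up_to_modification_def by blast
    have ae: "AE \<omega> in M. Z x \<omega> = A x \<omega>" if "x \<in> product_domain E" for x
      using mod[OF that] A that by (simp add: prob_eq_iff random_field_def)
    show "\<forall>x\<in>product_domain E. AE \<omega> in M.
       Z x \<omega> = (\<Sum>i\<in>UNIV. anchored_summand a (\<lambda>y. Z y \<omega>) i (x $ i))"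
    proof
      fix x assume x: "x \<in> product_domain E"
      have "AE \<omega> in M. \<forall>i\<in>UNIV. Z (replace_coord a i (x $ i)) \<omega> = A (replace_coord a i (x $ i)) \<omega>"
        using ae replaced[OF x] by (intro AE_finite_allI) auto
      with ae[OF x] ae[OF a]
      show "AE \<omega> in M. Z x \<omega> = (\<Sum>i\<in>UNIV. anchored_summand a (\<lambda>y. Z y \<omega>) i (x $ i))"
        using AE_space
      proof eventually_elim
        case (elim \<omega>)
        have "A x \<omega> = (\<Sum>i\<in>UNIV. anchored_summand a (\<lambda>y. A y \<omega>) i (x $ i))"
          using add[OF elim(4)] x unfolding additive_function_iff_anchored[OF a] by blast
        then show ?case using elim by (simp add: anchored_summand_def)
      qed
    qed
  next
    assume ae: "\<forall>x\<in>product_domain E. AE \<omega> in M.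
       Z x \<omega> = (\<Sum>i\<in>UNIV. anchored_summand a (\<lambda>y. Z y \<omega>) i (x $ i))"
    define A where "A x \<omega> = (\<Sum>i\<in>UNIV. anchored_summand a (\<lambda>y. Z y \<omega>) i (x $ i))" for x \<omega>
    have meas_A: "A x \<in> borel_measurable M" if "x \<in> product_domain E" for x
      unfolding A_def anchored_summand_def
      using meas_Z[OF a] meas_Z[OF replaced[OF that]] by simp
    show "additive_paths_up_to_modification M E Z"
      unfolding additive_paths_up_to_modification_def
    proof (intro exI conjI ballI)
      show "random_field M (product_domain E) A"
        using meas_A by (simp add: random_field_def)
      show "additive_function E (\<lambda>x. A x \<omega>)" for \<omega>
        unfolding additive_function_def A_def by blast
      show "\<P>(\<omega> in M. Z x \<omega> = A x \<omega>) = 1" if "x \<in> product_domain E" for x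
        using bspec[OF ae that] unfolding A_def[symmetric]
        by (simp add: prob_eq_iff[OF that meas_A[OF that]])
    qed
  qed
qed

theorem corollary1:
  fixes M :: "'w measure"
    and E :: "'d::finite \<Rightarrow> real set"
    and Z :: "real ^ 'd \<Rightarrow> 'w \<Rightarrow> real"
    and k :: "real ^ 'd \<Rightarrow> real ^ 'd \<Rightarrow> real"
  assumes "prob_space M"
    and "\<And>i. E i \<noteq> {}"
    and "random_field M (product_domain E) Z"
    and "centred M (product_domain E) Z"
    and "has_covariance_kernel M (product_domain E) Z k"
  shows "additive_paths_up_to_modification M E Z \<longleftrightarrow>
    positive_definite_kernel (product_domain E) k \<and>
    (\<exists>kk :: 'd \<Rightarrow> 'd \<Rightarrow> real \<Rightarrow> real \<Rightarrow> real.
       \<forall>x\<in>product_domain E. \<forall>x'\<in>product_domain E.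
         k x x' = (\<Sum>i\<in>UNIV. \<Sum>j\<in>UNIV. kk i j (x $ i) (x' $ j)))"
proof -
  let ?D = "product_domain E"
  interpret prob_space M by fact
  define a :: "real ^ 'd" where "a = (\<chi> i. SOME t. t \<in> E i)"
  have a: "a \<in> ?D"
    using assms(2) by (simp add: a_def product_domain_def some_in_eq)
  have sq: "square_integrable M (Z x)" if "x \<in> ?D" for x
    using that assms(3,5)
    by (simp add: square_integrable_def random_field_def has_covariance_kernel_def)
  have k: "k x y = (\<integral>\<omega>. Z x \<omega> * Z y \<omega> \<partial>M)" if "x \<in> ?D" "y \<in> ?D" for x y
    using that assms(4,5) by (simp add: has_covariance_kernel_def covariance_def centred_def)
  have replaced: "replace_coord a i (x $ i) \<in> ?D" if "x \<in> ?D" for x i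
    using a that by (simp add: replace_coord_in_product_domain product_domain_coord)
  define W where "W i t \<omega> = anchored_summand a (\<lambda>y. Z y \<omega>) i t" for i t \<omega>
  have sq_W: "square_integrable M (W i (x $ i))" if "x \<in> ?D" for i x
    using square_integrable_anchored_summand[OF sq[OF replaced[OF that]] sq[OF a]]
    by (simp add: W_def[abs_def])
  have "positive_definite_kernel ?D k"
    using sq k by (rule positive_definite_kernel_second_moments)
  moreover have "(\<exists>kk :: 'd \<Rightarrow> 'd \<Rightarrow> real \<Rightarrow> real \<Rightarrow> real.
       \<forall>x\<in>?D. \<forall>x'\<in>?D. k x x' = (\<Sum>i\<in>UNIV. \<Sum>j\<in>UNIV. kk i j (x $ i) (x' $ j))) \<longleftrightarrow>
     (\<forall>x\<in>?D. AE \<omega> in M. Z x \<omega> = (\<Sum>i\<in>UNIV. W i (x $ i) \<omega>))"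
    (is "?split \<longleftrightarrow> ?anchored")
  proof
    assume ae: ?anchored
    show ?split
    proof (intro exI ballI)
      fix x x' assume x: "x \<in> ?D" and x': "x' \<in> ?D"
      have "k x x' = (\<integral>\<omega>. (\<Sum>i\<in>UNIV. W i (x $ i) \<omega>) * (\<Sum>j\<in>UNIV. W j (x' $ j) \<omega>) \<partial>M)"
        unfolding k[OF x x']
      proof (rule integral_cong_AE)
        show "AE \<omega> in M. Z x \<omega> * Z x' \<omega> =
            (\<Sum>i\<in>UNIV. W i (x $ i) \<omega>) * (\<Sum>j\<in>UNIV. W j (x' $ j) \<omega>)"
          using bspec[OF ae x] bspec[OF ae x'] by eventually_elim simp
      qed (use sq[OF x] sq[OF x'] sq_W[OF x] sq_W[OF x'] in
          \<open>simp_all add: square_integrable_measurable\<close>)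
      then show "k x x' = (\<Sum>i\<in>UNIV. \<Sum>j\<in>UNIV.
          (\<lambda>i j s t. \<integral>\<omega>. W i s \<omega> * W j t \<omega> \<partial>M) i j (x $ i) (x' $ j))"
        using x x' by (simp add: integral_sum_mult_sum sq_W)
    qed
  next
    assume ?split
    then obtain kk :: "'d \<Rightarrow> 'd \<Rightarrow> real \<Rightarrow> real \<Rightarrow> real" where
      kk: "\<And>x y. x \<in> ?D \<Longrightarrow> y \<in> ?D \<Longrightarrow>
        k x y = (\<Sum>i\<in>UNIV. \<Sum>j\<in>UNIV. kk i j (x $ i) (y $ j))"
      by blast
    show ?anchored
    proof
      fix x assume x: "x \<in> ?D"
      define R where "R \<omega> = Z x \<omega> - (\<Sum>i\<in>UNIV. W i (x $ i) \<omega>)" for \<omega>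
      have sq_R: "square_integrable M R"
        unfolding R_def[abs_def]
        by (intro square_integrable_diff square_integrable_sum sq sq_W x)
      have orth: "(\<integral>\<omega>. Z y \<omega> * R \<omega> \<partial>M) = 0" if y: "y \<in> ?D" for y
      proof -
        have "additive_function E (\<lambda>u. k u y)"
          unfolding additive_function_def
          using kk y
          by (intro exI[of _ "\<lambda>i t. \<Sum>j\<in>UNIV. kk i j t (y $ j)"]) simp
        then have add: "k x y = (\<Sum>i\<in>UNIV. anchored_summand a (\<lambda>u. k u y) i (x $ i))"
          using x unfolding additive_function_iff_anchored[OF a] by blast
        have W_y: "(\<integral>\<omega>. W i (x $ i) \<omega> * Z y \<omega> \<partial>M) = anchored_summand a (\<lambda>u. k u y) i (x $ i)" for i
          unfolding W_def
            integral_anchored_summand_mult[OF sq[OF replaced[OF x]] sq[OF a] sq[OF y]]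
          by (rule anchored_summand_cong[where E = E])
            (use a x y in \<open>simp_all add: k product_domain_coord\<close>)
        have "(\<integral>\<omega>. Z y \<omega> * R \<omega> \<partial>M) =
            (\<integral>\<omega>. Z x \<omega> * Z y \<omega> - (\<Sum>i\<in>UNIV. W i (x $ i) \<omega> * Z y \<omega>) \<partial>M)"
          by (simp add: R_def right_diff_distrib sum_distrib_left mult.commute)
        also have "\<dots> = k x y - (\<Sum>i\<in>UNIV. \<integral>\<omega>. W i (x $ i) \<omega> * Z y \<omega> \<partial>M)"
          using x y by (simp add: k integrable_mult_square_integrable sq sq_W
              Bochner_Integration.integral_diff Bochner_Integration.integral_sum)
        finally show ?thesis using add by (simp add: W_y)
      qed
      \<comment> \<open>A canonical summand is a combination of two values of the field, both orthogonal to \<open>R\<close>.\<close>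
      have orth_W: "(\<integral>\<omega>. W i (x $ i) \<omega> * R \<omega> \<partial>M) = 0" for i
        unfolding W_def integral_anchored_summand_mult[OF sq[OF replaced[OF x]] sq[OF a] sq_R]
        by (simp add: anchored_summand_def orth a replaced x)
      have "(\<integral>\<omega>. R \<omega> * R \<omega> \<partial>M) =
          (\<integral>\<omega>. Z x \<omega> * R \<omega> - (\<Sum>i\<in>UNIV. W i (x $ i) \<omega> * R \<omega>) \<partial>M)"
        by (subst (1) R_def) (simp add: left_diff_distrib sum_distrib_right)
      also have "\<dots> = 0"
        using x by (simp add: integrable_mult_square_integrable sq sq_W sq_R orth orth_W
            Bochner_Integration.integral_diff Bochner_Integration.integral_sum)
      finally have "AE \<omega> in M. R \<omega> * R \<omega> = 0"
        using integrable_mult_square_integrable[OF sq_R sq_R]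
        by (subst (asm) integral_nonneg_eq_0_iff_AE) auto
      then show "AE \<omega> in M. Z x \<omega> = (\<Sum>i\<in>UNIV. W i (x $ i) \<omega>)"
        by eventually_elim (simp add: R_def)
    qed
  qed
  moreover have "additive_paths_up_to_modification M E Z \<longleftrightarrow>
      (\<forall>x\<in>?D. AE \<omega> in M. Z x \<omega> = (\<Sum>i\<in>UNIV. W i (x $ i) \<omega>))"
    unfolding W_def by (rule additive_paths_up_to_modification_iff_anchored[OF assms(1) a assms(3)])
  ultimately show ?thesis by blast
qed

end
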